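(* Let $*k$ be a nimber. Then $*k$ is indecomposable if and only if $k$ is a power of $2$.
   Context: All games are short (finite) two-player partizan combinatorial games under normal play (a player who cannot move loses). $+$ denotes the disjunctive sum, and $=$ denotes the usual equality of game values. For a nonnegative integer $k$, the nimber $*k$ is the game $\{*0,\ldots,*(k-1)\mid *0,\ldots,*(k-1)\}$, with $*0=0$. Powers of $2$ are the integers $2^n$ with $n$ a nonnegative integer. The birthday $b(G)$ is the height of the game tree of the canonical form of $G$. A game $G$ is decomposable if there are (arbitrary short) games $H$ and $J$ such that $b(H)<b(G)$, $b(J)<b(G)$ and $G=H+J$. If there are no such $H,J$, then $G$ is indecomposable.
   Formalization: The formal theorem assumes k > 0: for k = 0 the claim fails, since *0 has birthday 0 and is vacuously indecomposable, while 0 is not a power of 2. *)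

theory Defs
  imports "HOL-Library.FSet"
begin

datatype game = Game (left_opts: "game fset") (right_opts: "game fset")

lemma size_left_option: "x |\<in>| left_opts G \<Longrightarrow> size x < size G"
proof (cases G)
  case (Game L R)
  assume "x |\<in>| left_opts G"
  then have "Suc (size x) \<le> (\<Sum>y\<in>fset L. Suc (size y))"
    using Game by (intro member_le_sum) auto
  then show ?thesis using Game by (simp add: size_fset_simps)
qed

lemma size_right_option: "x |\<in>| right_opts G \<Longrightarrow> size x < size G"
proof (cases G)
  case (Game L R)
  assume "x |\<in>| right_opts G"
  then have "Suc (size x) \<le> (\<Sum>y\<in>fset R. Suc (size y))"
    using Game by (intro member_le_sum) auto
  then show ?thesis using Game by (simp add: size_fset_simps)
qed

function game_sum :: "game \<Rightarrow> game \<Rightarrow> game" (infixl "\<oplus>" 65) where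
  "G \<oplus> H = Game
     ((\<lambda>GL. GL \<oplus> H) |`| left_opts G |\<union>| (\<lambda>HL. G \<oplus> HL) |`| left_opts H)
     ((\<lambda>GR. GR \<oplus> H) |`| right_opts G |\<union>| (\<lambda>HR. G \<oplus> HR) |`| right_opts H)"
  by pat_completeness auto
termination
  by (relation "measure (\<lambda>(G, H). size G + size H)")
    (auto simp: size_left_option size_right_option)

text \<open>\<open>G \<preceq> H\<close> says that Right, moving second, wins \<open>G - H\<close>: Left has no winning first move,
  neither to \<open>GL - H\<close> nor to \<open>G - HR\<close>.\<close>

function game_le :: "game \<Rightarrow> game \<Rightarrow> bool" (infix "\<preceq>" 50) where
  "G \<preceq> H \<longleftrightarrow>
     (\<forall>GL. GL |\<in>| left_opts G \<longrightarrow> \<not> H \<preceq> GL) \<and>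
     (\<forall>HR. HR |\<in>| right_opts H \<longrightarrow> \<not> HR \<preceq> G)"
  by pat_completeness auto
termination
  by (relation "measure (\<lambda>(G, H). size G + size H)")
    (auto simp: size_left_option size_right_option)

declare game_sum.simps [simp del] game_le.simps [simp del]

text \<open>Equality of game values; HOL equality on \<^typ>\<open>game\<close> is isomorphism of game trees with
  duplicate options merged.\<close>

definition game_eq :: "game \<Rightarrow> game \<Rightarrow> bool" (infix "\<approx>" 50) where
  "G \<approx> H \<longleftrightarrow> G \<preceq> H \<and> H \<preceq> G"

function nimber :: "nat \<Rightarrow> game" where
  "nimber k = Game (nimber |`| fset_of_list [0..<k]) (nimber |`| fset_of_list [0..<k])"
  by pat_completeness auto
termination
  by (relation "measure id") (auto simp: fset_of_list_elem)

declare nimber.simps [simp del]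

function height :: "game \<Rightarrow> nat" where
  "height G = Max (insert 0 ((\<lambda>X. Suc (height X)) `
     (fset (left_opts G) \<union> fset (right_opts G))))"
  by pat_completeness auto
termination
  by (relation "measure size") (auto simp: size_left_option size_right_option)

declare height.simps [simp del]

definition no_dominated_opts :: "game \<Rightarrow> bool" where
  "no_dominated_opts G \<longleftrightarrow>
     (\<forall>A B. A |\<in>| left_opts G \<longrightarrow> B |\<in>| left_opts G \<longrightarrow> A \<preceq> B \<longrightarrow> A = B) \<and>
     (\<forall>A B. A |\<in>| right_opts G \<longrightarrow> B |\<in>| right_opts G \<longrightarrow> A \<preceq> B \<longrightarrow> A = B)"

definition no_reversible_opts :: "game \<Rightarrow> bool" where
  "no_reversible_opts G \<longleftrightarrow>
     (\<forall>A B. A |\<in>| left_opts G \<longrightarrow> B |\<in>| right_opts A \<longrightarrow> \<not> B \<preceq> G) \<and>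
     (\<forall>A B. A |\<in>| right_opts G \<longrightarrow> B |\<in>| left_opts A \<longrightarrow> \<not> G \<preceq> B)"

function canonical :: "game \<Rightarrow> bool" where
  "canonical G \<longleftrightarrow> no_dominated_opts G \<and> no_reversible_opts G \<and>
     (\<forall>X. X |\<in>| left_opts G \<longrightarrow> canonical X) \<and>
     (\<forall>X. X |\<in>| right_opts G \<longrightarrow> canonical X)"
  by pat_completeness auto
termination
  by (relation "measure size") (auto simp: size_left_option size_right_option)

declare canonical.simps [simp del]

definition canonical_form :: "game \<Rightarrow> game" where
  "canonical_form G = (THE K. canonical K \<and> K \<approx> G)"

definition birthday :: "game \<Rightarrow> nat" where
  "birthday G = height (canonical_form G)"

definition decomposable :: "game \<Rightarrow> bool" where
  "decomposable G \<longleftrightarrow>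
     (\<exists>H J. birthday H < birthday G \<and> birthday J < birthday G \<and> G \<approx> H \<oplus> J)"

abbreviation indecomposable :: "game \<Rightarrow> bool" where
  "indecomposable G \<equiv> \<not> decomposable G"


subsection \<open>Existence and uniqueness of the canonical form\<close>

lemma game_le_refl: "G \<preceq> G"
proof (induction "size G" arbitrary: G rule: less_induct)
  case less
  have "\<not> G \<preceq> X" if "X |\<in>| left_opts G" for X
    using less[OF size_left_option[OF that]] that game_le.simps[of G X] by blast
  moreover have "\<not> X \<preceq> G" if "X |\<in>| right_opts G" for X
    using less[OF size_right_option[OF that]] that game_le.simps[of X G] by blast
  ultimately show ?case using game_le.simps[of G G] by blast
qed

lemma game_le_trans: "G \<preceq> H \<Longrightarrow> H \<preceq> K \<Longrightarrow> G \<preceq> K"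
proof (induction "size G + size H + size K" arbitrary: G H K rule: less_induct)
  case less
  have "\<not> K \<preceq> X" if X: "X |\<in>| left_opts G" for X
  proof
    assume "K \<preceq> X"
    then have "H \<preceq> X" using less.hyps[of H K X] less.prems size_left_option[OF X] by simp
    then show False using less.prems(1) X game_le.simps[of G H] by blast
  qed
  moreover have "\<not> X \<preceq> G" if X: "X |\<in>| right_opts K" for X
  proof
    assume "X \<preceq> G"
    then have "X \<preceq> H" using less.hyps[of X G H] less.prems size_right_option[OF X] by simp
    then show False using less.prems(2) X game_le.simps[of H K] by blast
  qed
  ultimately show ?case using game_le.simps[of G K] by blast
qed

lemma not_le_left_option: "X |\<in>| left_opts G \<Longrightarrow> \<not> G \<preceq> X"
  using game_le_refl game_le.simps[of G G] by blast

lemma not_right_option_le: "X |\<in>| right_opts G \<Longrightarrow> \<not> X \<preceq> G"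
  using game_le_refl game_le.simps[of G G] by blast

lemma game_eq_refl: "G \<approx> G"
  by (simp add: game_eq_def game_le_refl)

lemma game_eq_sym: "G \<approx> H \<Longrightarrow> H \<approx> G"
  by (simp add: game_eq_def)

lemma game_eq_trans: "G \<approx> H \<Longrightarrow> H \<approx> K \<Longrightarrow> G \<approx> K"
  unfolding game_eq_def using game_le_trans by blast

lemma canonical_left_option: "canonical G \<Longrightarrow> X |\<in>| left_opts G \<Longrightarrow> canonical X"
  using canonical.simps[of G] by blast

lemma canonical_right_option: "canonical G \<Longrightarrow> X |\<in>| right_opts G \<Longrightarrow> canonical X"
  using canonical.simps[of G] by blast

lemma canonical_left_match:
  assumes "canonical G" "canonical H" "G \<approx> H" "A |\<in>| left_opts G"
  obtains B where "B |\<in>| left_opts H" "A \<approx> B"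
proof -
  have step: "\<exists>B. B |\<in>| left_opts H \<and> A \<preceq> B"
    if "canonical G" "G \<approx> H" "A |\<in>| left_opts G" for G H A
  proof -
    have "\<not> H \<preceq> A"
      using that game_le.simps[of G H] unfolding game_eq_def by blast
    moreover have "\<not> X \<preceq> H" if X: "X |\<in>| right_opts A" for X
    proof
      assume "X \<preceq> H"
      then have "X \<preceq> G" using \<open>G \<approx> H\<close> game_le_trans unfolding game_eq_def by blast
      then show False
        using X \<open>canonical G\<close> \<open>A |\<in>| left_opts G\<close> canonical.simps[of G]
        unfolding no_reversible_opts_def by blast
    qed
    ultimately show ?thesis using game_le.simps[of H A] by blast
  qed
  obtain B where B: "B |\<in>| left_opts H" "A \<preceq> B" using step assms by blast
  obtain C where C: "C |\<in>| left_opts G" "B \<preceq> C"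
    using step[of H G B] assms B game_eq_sym by blast
  have "A \<preceq> C" using B C game_le_trans by blast
  then have "A = C"
    using assms C canonical.simps[of G] unfolding no_dominated_opts_def by blast
  then show ?thesis using that B C unfolding game_eq_def by blast
qed

lemma canonical_right_match:
  assumes "canonical G" "canonical H" "G \<approx> H" "A |\<in>| right_opts G"
  obtains B where "B |\<in>| right_opts H" "A \<approx> B"
proof -
  have step: "\<exists>B. B |\<in>| right_opts H \<and> B \<preceq> A"
    if "canonical G" "G \<approx> H" "A |\<in>| right_opts G" for G H A
  proof -
    have "\<not> A \<preceq> H"
      using that game_le.simps[of H G] unfolding game_eq_def by blast
    moreover have "\<not> H \<preceq> X" if X: "X |\<in>| left_opts A" for X
    proof
      assume "H \<preceq> X"
      then have "G \<preceq> X" using \<open>G \<approx> H\<close> game_le_trans unfolding game_eq_def by blast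
      then show False
        using X \<open>canonical G\<close> \<open>A |\<in>| right_opts G\<close> canonical.simps[of G]
        unfolding no_reversible_opts_def by blast
    qed
    ultimately show ?thesis using game_le.simps[of A H] by blast
  qed
  obtain B where B: "B |\<in>| right_opts H" "B \<preceq> A" using step assms by blast
  obtain C where C: "C |\<in>| right_opts G" "C \<preceq> B"
    using step[of H G B] assms B game_eq_sym by blast
  have "C \<preceq> A" using B C game_le_trans by blast
  then have "A = C"
    using assms C canonical.simps[of G] unfolding no_dominated_opts_def by blast
  then show ?thesis using that B C unfolding game_eq_def by blast
qed

lemma canonical_unique: "canonical G \<Longrightarrow> canonical H \<Longrightarrow> G \<approx> H \<Longrightarrow> G = H"
proof (induction "size G + size H" arbitrary: G H rule: less_induct)
  case less
  have L: "A |\<in>| left_opts H'"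
    if h: "canonical G'" "canonical H'" "G' \<approx> H'" "A |\<in>| left_opts G'"
      "size G' + size H' = size G + size H" for G' H' A
  proof -
    obtain B where B: "B |\<in>| left_opts H'" "A \<approx> B" using canonical_left_match h by blast
    have "A = B"
      using less.hyps[of A B] B h canonical_left_option
        size_left_option[OF B(1)] size_left_option[OF h(4)] by fastforce
    then show ?thesis using B by simp
  qed
  have R: "A |\<in>| right_opts H'"
    if h: "canonical G'" "canonical H'" "G' \<approx> H'" "A |\<in>| right_opts G'"
      "size G' + size H' = size G + size H" for G' H' A
  proof -
    obtain B where B: "B |\<in>| right_opts H'" "A \<approx> B" using canonical_right_match h by blast
    have "A = B"
      using less.hyps[of A B] B h canonical_right_option
        size_right_option[OF B(1)] size_right_option[OF h(4)] by fastforce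
    then show ?thesis using B by simp
  qed
  note s = game_eq_sym[OF less.prems(3)]
  have "left_opts G = left_opts H" "right_opts G = right_opts H"
    using L[of G H] L[of H G] R[of G H] R[of H G] less.prems s by (auto simp: add.commute)
  then show ?case by (simp add: game.expand)
qed

text \<open>A game of least size among those of equal value is canonical.\<close>

lemma size_game: "size G = (\<Sum>x\<in>fset (left_opts G). Suc (size x))
    + (\<Sum>x\<in>fset (right_opts G). Suc (size x)) + 1"
  by (cases G) (simp add: size_fset_simps)

lemma sum_replace:
  fixes f :: "'a \<Rightarrow> nat"
  assumes "A |\<in>| L" "(\<Sum>x\<in>fset N. f x) < f A"
  shows "(\<Sum>x\<in>fset (L |-| {|A|} |\<union>| N). f x) < (\<Sum>x\<in>fset L. f x)"
proof -
  have "(\<Sum>x\<in>fset (L |-| {|A|} |\<union>| N). f x) \<le> (\<Sum>x\<in>fset L - {A}. f x) + (\<Sum>x\<in>fset N. f x)"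
    using sum_Un_nat[of "fset L - {A}" "fset N" f] by simp
  also have "\<dots> < (\<Sum>x\<in>fset L - {A}. f x) + f A" using assms(2) by simp
  also have "\<dots> = (\<Sum>x\<in>fset L. f x)" using assms(1) by (simp add: sum.remove)
  finally show ?thesis .
qed

lemma size_replace_left:
  assumes "A |\<in>| left_opts G" "(\<Sum>x\<in>fset N. Suc (size x)) < Suc (size A)"
  shows "size (Game (left_opts G |-| {|A|} |\<union>| N) (right_opts G)) < size G"
  using sum_replace[OF assms] size_game[of G]
    size_game[of "Game (left_opts G |-| {|A|} |\<union>| N) (right_opts G)"] by simp

lemma size_replace_right:
  assumes "A |\<in>| right_opts G" "(\<Sum>x\<in>fset N. Suc (size x)) < Suc (size A)"
  shows "size (Game (left_opts G) (right_opts G |-| {|A|} |\<union>| N)) < size G"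
  using sum_replace[OF assms] size_game[of G]
    size_game[of "Game (left_opts G) (right_opts G |-| {|A|} |\<union>| N)"] by simp

definition least_size :: "game \<Rightarrow> bool" where
  "least_size G \<longleftrightarrow> (\<forall>K. K \<approx> G \<longrightarrow> size G \<le> size K)"

lemma least_size_no_replace_left:
  assumes "least_size G" "A |\<in>| left_opts G" "(\<Sum>x\<in>fset N. Suc (size x)) < Suc (size A)"
  shows "\<not> Game (left_opts G |-| {|A|} |\<union>| N) (right_opts G) \<approx> G"
  using assms size_replace_left[OF assms(2,3)] unfolding least_size_def by (meson not_less)

lemma least_size_no_replace_right:
  assumes "least_size G" "A |\<in>| right_opts G" "(\<Sum>x\<in>fset N. Suc (size x)) < Suc (size A)"
  shows "\<not> Game (left_opts G) (right_opts G |-| {|A|} |\<union>| N) \<approx> G"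
  using assms size_replace_right[OF assms(2,3)] unfolding least_size_def by (meson not_less)

text \<open>Sufficient conditions for a replacement of options to keep the value.\<close>

lemma game_leI:
  assumes "\<And>A. A |\<in>| left_opts G \<Longrightarrow> \<not> H \<preceq> A"
    and "\<And>B. B |\<in>| right_opts H \<Longrightarrow> \<not> B \<preceq> G"
  shows "G \<preceq> H"
  using assms game_le.simps[of G H] by blast

lemma not_le_if_le_left:
  "X \<preceq> Y \<Longrightarrow> Y |\<in>| left_opts H \<Longrightarrow> \<not> H \<preceq> X"
  using game_le_trans not_le_left_option by blast

lemma not_le_if_right_le:
  "Y \<preceq> X \<Longrightarrow> Y |\<in>| right_opts H \<Longrightarrow> \<not> X \<preceq> H"
  using game_le_trans not_right_option_le by blast

lemma least_size_canonical: "least_size G \<Longrightarrow> canonical G"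
proof (induction "size G" arbitrary: G rule: less_induct)
  case less
  note no_left = least_size_no_replace_left[OF less.prems]
  note no_right = least_size_no_replace_right[OF less.prems]
  have dom_left: "A = B"
    if AB: "A |\<in>| left_opts G" "B |\<in>| left_opts G" "A \<preceq> B" for A B
  proof (rule ccontr)
    assume ne: "A \<noteq> B"
    let ?K = "Game (left_opts G |-| {|A|} |\<union>| {||}) (right_opts G)"
    have "?K \<preceq> G"
    proof (rule game_leI)
      fix X assume "X |\<in>| right_opts G"
      then show "\<not> X \<preceq> ?K" using not_le_if_right_le[OF game_le_refl, of X ?K] by auto
    qed (use not_le_left_option in auto)
    moreover have "G \<preceq> ?K"
    proof (rule game_leI)
      fix X assume "X |\<in>| left_opts G"
      then show "\<not> ?K \<preceq> X"
        using AB ne not_le_if_le_left[of X B ?K] not_le_if_le_left[OF game_le_refl, of X ?K]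
        by (cases "X = A") auto
    qed (use not_right_option_le in auto)
    ultimately show False using no_left[of A "{||}"] AB unfolding game_eq_def by simp
  qed
  have dom_right: "A = B"
    if AB: "A |\<in>| right_opts G" "B |\<in>| right_opts G" "A \<preceq> B" for A B
  proof (rule ccontr)
    assume ne: "A \<noteq> B"
    let ?K = "Game (left_opts G) (right_opts G |-| {|B|} |\<union>| {||})"
    have "G \<preceq> ?K"
    proof (rule game_leI)
      fix X assume "X |\<in>| left_opts G"
      then show "\<not> ?K \<preceq> X" using not_le_if_le_left[OF game_le_refl, of X ?K] by auto
    qed (use not_right_option_le in auto)
    moreover have "?K \<preceq> G"
    proof (rule game_leI)
      fix X assume "X |\<in>| right_opts G"
      then show "\<not> X \<preceq> ?K"
        using AB ne not_le_if_right_le[of A X ?K] not_le_if_right_le[OF game_le_refl, of X ?K]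
        by (cases "X = B") auto
    qed (use not_le_left_option in auto)
    ultimately show False using no_right[of B "{||}"] AB unfolding game_eq_def by simp
  qed
  have rev_left: "\<not> B \<preceq> G"
    if AB: "A |\<in>| left_opts G" "B |\<in>| right_opts A" for A B
  proof
    assume BG: "B \<preceq> G"
    let ?K = "Game (left_opts G |-| {|A|} |\<union>| left_opts B) (right_opts G)"
    have BL: "\<not> G \<preceq> X" if "X |\<in>| left_opts B" for X
      using BG that game_le.simps[of B G] by blast
    have "?K \<preceq> G"
    proof (rule game_leI)
      fix X assume "X |\<in>| right_opts G"
      then show "\<not> X \<preceq> ?K" using not_le_if_right_le[OF game_le_refl, of X ?K] by auto
    qed (use BL not_le_left_option in auto)
    moreover have KB: "B \<preceq> ?K"
    proof (rule game_leI)
      fix X assume "X |\<in>| left_opts B"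
      then show "\<not> ?K \<preceq> X" using not_le_if_le_left[OF game_le_refl, of X ?K] by auto
    next
      fix X assume "X |\<in>| right_opts ?K"
      then show "\<not> X \<preceq> B"
        using BG game_le_trans not_right_option_le[of X G] by auto
    qed
    moreover have "G \<preceq> ?K"
    proof (rule game_leI)
      fix X assume X: "X |\<in>| left_opts G"
      show "\<not> ?K \<preceq> X"
      proof (cases "X = A")
        case True
        then show ?thesis
          using AB(2) KB game_le_trans not_right_option_le by blast
      next
        case False
        then show ?thesis using X not_le_if_le_left[OF game_le_refl, of X ?K] by auto
      qed
    qed (use not_right_option_le in auto)
    moreover have "(\<Sum>x\<in>fset (left_opts B). Suc (size x)) < Suc (size A)"
      using size_right_option[OF AB(2)] size_game[of B] by simp
    ultimately show False using no_left AB unfolding game_eq_def by blast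
  qed
  have rev_right: "\<not> G \<preceq> B"
    if AB: "A |\<in>| right_opts G" "B |\<in>| left_opts A" for A B
  proof
    assume GB: "G \<preceq> B"
    let ?K = "Game (left_opts G) (right_opts G |-| {|A|} |\<union>| right_opts B)"
    have BR: "\<not> X \<preceq> G" if "X |\<in>| right_opts B" for X
      using GB that game_le.simps[of G B] by blast
    have "G \<preceq> ?K"
    proof (rule game_leI)
      fix X assume "X |\<in>| left_opts G"
      then show "\<not> ?K \<preceq> X" using not_le_if_le_left[OF game_le_refl, of X ?K] by auto
    qed (use BR not_right_option_le in auto)
    moreover have KB: "?K \<preceq> B"
    proof (rule game_leI)
      fix X assume "X |\<in>| right_opts B"
      then show "\<not> X \<preceq> ?K" using not_le_if_right_le[OF game_le_refl, of X ?K] by auto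
    next
      fix X assume "X |\<in>| left_opts ?K"
      then show "\<not> B \<preceq> X"
        using GB game_le_trans not_le_left_option[of X G] by auto
    qed
    moreover have "?K \<preceq> G"
    proof (rule game_leI)
      fix X assume X: "X |\<in>| right_opts G"
      show "\<not> X \<preceq> ?K"
      proof (cases "X = A")
        case True
        then show ?thesis
          using AB(2) KB game_le_trans not_le_left_option by blast
      next
        case False
        then show ?thesis using X not_le_if_right_le[OF game_le_refl, of X ?K] by auto
      qed
    qed (use not_le_left_option in auto)
    moreover have "(\<Sum>x\<in>fset (right_opts B). Suc (size x)) < Suc (size A)"
      using size_left_option[OF AB(2)] size_game[of B] by simp
    ultimately show False using no_right AB unfolding game_eq_def by blast
  qed
  have sub_left: "canonical A" if A: "A |\<in>| left_opts G" for A
  proof (rule less.hyps[OF size_left_option[OF A]], unfold least_size_def, intro allI impI, rule ccontr)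
    fix X assume X: "X \<approx> A" "\<not> size A \<le> size X"
    let ?K = "Game (left_opts G |-| {|A|} |\<union>| {|X|}) (right_opts G)"
    have "?K \<preceq> G"
    proof (rule game_leI)
      fix Y assume "Y |\<in>| right_opts G"
      then show "\<not> Y \<preceq> ?K" using not_le_if_right_le[OF game_le_refl, of Y ?K] by auto
    qed (use X(1) not_le_left_option not_le_if_le_left[of X A G] A in \<open>auto simp: game_eq_def\<close>)
    moreover have "G \<preceq> ?K"
    proof (rule game_leI)
      fix Y assume "Y |\<in>| left_opts G"
      then show "\<not> ?K \<preceq> Y"
        using X(1) not_le_if_le_left[of Y X ?K] not_le_if_le_left[OF game_le_refl, of Y ?K]
        by (cases "Y = A") (auto simp: game_eq_def)
    qed (use not_right_option_le in auto)
    moreover have "(\<Sum>x\<in>fset {|X|}. Suc (size x)) < Suc (size A)" using X by simp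
    ultimately show False using no_left A unfolding game_eq_def by blast
  qed
  have sub_right: "canonical A" if A: "A |\<in>| right_opts G" for A
  proof (rule less.hyps[OF size_right_option[OF A]], unfold least_size_def, intro allI impI, rule ccontr)
    fix X assume X: "X \<approx> A" "\<not> size A \<le> size X"
    let ?K = "Game (left_opts G) (right_opts G |-| {|A|} |\<union>| {|X|})"
    have "G \<preceq> ?K"
    proof (rule game_leI)
      fix Y assume "Y |\<in>| left_opts G"
      then show "\<not> ?K \<preceq> Y" using not_le_if_le_left[OF game_le_refl, of Y ?K] by auto
    qed (use X(1) not_right_option_le not_le_if_right_le[of A X G] A in \<open>auto simp: game_eq_def\<close>)
    moreover have "?K \<preceq> G"
    proof (rule game_leI)
      fix Y assume "Y |\<in>| right_opts G"
      then show "\<not> Y \<preceq> ?K"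
        using X(1) not_le_if_right_le[of X Y ?K] not_le_if_right_le[OF game_le_refl, of Y ?K]
        by (cases "Y = A") (auto simp: game_eq_def)
    qed (use not_le_left_option in auto)
    moreover have "(\<Sum>x\<in>fset {|X|}. Suc (size x)) < Suc (size A)" using X by simp
    ultimately show False using no_right A unfolding game_eq_def by blast
  qed
  show ?case
    using canonical.simps[of G] dom_left dom_right rev_left rev_right sub_left sub_right
    unfolding no_dominated_opts_def no_reversible_opts_def by blast
qed

theorem canonical_form_ex1: "\<exists>!K. canonical K \<and> K \<approx> G"
proof -
  obtain K where K: "K \<approx> G" "\<And>K'. K' \<approx> G \<Longrightarrow> size K \<le> size K'"
    using ex_has_least_nat[of "\<lambda>K. K \<approx> G" G size] game_eq_refl by blast
  then have "least_size K" unfolding least_size_def using game_eq_trans by blast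
  then show ?thesis
    using K least_size_canonical canonical_unique game_eq_sym game_eq_trans by metis
qed

lemma canonical_form_eqI: "canonical K \<Longrightarrow> K \<approx> G \<Longrightarrow> canonical_form G = K"
  unfolding canonical_form_def using canonical_form_ex1 by (intro the1_equality) auto


subsection \<open>Nimbers\<close>

lemma left_opts_nimber: "x |\<in>| left_opts (nimber k) \<longleftrightarrow> (\<exists>j<k. x = nimber j)"
  by (auto simp: nimber.simps[of k] fimage_iff fset_of_list_elem)

lemma right_opts_nimber: "x |\<in>| right_opts (nimber k) \<longleftrightarrow> (\<exists>j<k. x = nimber j)"
  by (auto simp: nimber.simps[of k] fimage_iff fset_of_list_elem)

lemma nimber_le_iff: "nimber j \<preceq> nimber k \<longleftrightarrow> j = k"
proof
  assume "nimber j \<preceq> nimber k"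
  then show "j = k"
    using not_le_left_option[of "nimber k" "nimber j"] not_right_option_le[of "nimber j" "nimber k"]
      left_opts_nimber right_opts_nimber game_le.simps[of "nimber j" "nimber k"]
      game_le_refl by (metis linorder_neqE_nat)
qed (simp add: game_le_refl)

lemma canonical_nimber: "canonical (nimber k)"
proof (induction k rule: less_induct)
  case (less k)
  then show ?case
    unfolding canonical.simps[of "nimber k"] no_dominated_opts_def no_reversible_opts_def
    by (auto simp: left_opts_nimber right_opts_nimber nimber_le_iff)
qed

lemma birthday_nimber: "birthday (nimber k) = k"
proof -
  have "height (nimber k) = k"
  proof (induction k rule: less_induct)
    case (less k)
    have "fset (left_opts (nimber k)) \<union> fset (right_opts (nimber k)) = nimber ` {..<k}"
      using left_opts_nimber right_opts_nimber by auto
    moreover have "(\<lambda>X. Suc (height X)) ` nimber ` {..<k} = Suc ` {..<k}"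
      using less by (simp add: image_image)
    moreover have "insert 0 (Suc ` {..<k}) = {..k}"
      by (simp add: lessThan_Suc_eq_insert_0[symmetric] lessThan_Suc_atMost)
    moreover have "Max {..k} = k" by (rule Max_eqI) auto
    ultimately show ?case by (simp add: height.simps[of "nimber k"])
  qed
  then show ?thesis
    using canonical_form_eqI[OF canonical_nimber game_eq_refl] by (simp add: birthday_def)
qed

text \<open>The zero game is vacuously indecomposable, although \<open>0\<close> is not a power of two.\<close>

lemma indecomposable_nimber_0: "indecomposable (nimber 0)"
  by (simp add: decomposable_def birthday_nimber)

end

theory Submission
  imports Defs
begin

text \<open>If \<open>*k\<close> with \<open>k = 2 ^ n\<close> equals \<open>H + J\<close>, then \<open>J = Z + *k\<close> for \<open>Z = -H\<close>, and \<open>Z\<close> has the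
  birthday of \<open>H\<close>. The key fact is that every \<open>Z\<close> admits an \<open>m\<close> such that
  \<open>Z + *q\<close> has birthday at least \<open>q XOR m\<close> for all \<open>q\<close>; taking \<open>q = 0\<close> gives \<open>m < 2 ^ n\<close>, and
  then \<open>q = 2 ^ n\<close> shows that \<open>J\<close> has birthday at least \<open>2 ^ n\<close>.

  The key fact is proved by induction on the birthday of \<open>Z\<close>, which may be taken canonical and of
  least birthday among the games \<open>Z + *r\<close>. If some left option \<open>A\<close> of \<open>Z\<close> satisfies
  \<open>A \<ge> Z + *j\<close>, then \<open>A + *q\<close> is neither dominated nor reversible in \<open>Z + *q\<close>, so
  \<open>A\<close> inherits the problem with a smaller birthday; dually for right options. If there is no such
  option, then every \<open>Z + *p\<close> with \<open>p < q\<close> survives in the canonical form of \<open>Z + *q\<close>, hence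
  \<open>m = 0\<close> works.\<close>

unbundle bit_operations_syntax

subsection \<open>Bitwise exclusive or\<close>

text \<open>At the highest bit where \<open>c\<close> and \<open>a XOR b\<close> differ, exactly one
  of \<open>a\<close> and \<open>b\<close> has a one, and it is this number that the replacement
  lowers. In Nim terms, every value below a nim-sum is reached by lowering one summand.\<close>

lemma xor_less_cases:
  fixes a b c :: nat
  assumes "c < a XOR b"
  shows "c XOR b < a \<or> c XOR a < b"
  using assms
proof (induction "a + b" arbitrary: a b c rule: less_induct)
  case less
  note rec = xor_nat_rec[of a b] xor_nat_rec[of c b] xor_nat_rec[of c a]
  \<comment> \<open>Either the bits above the lowest decide the comparison, or they agree and the
    lowest bit decides.\<close>
  consider "c div 2 < (a div 2) XOR (b div 2)"
    | "c div 2 = (a div 2) XOR (b div 2)" "even c" "odd a \<noteq> odd b"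
  proof -
    have "c < of_bool (odd a \<noteq> odd b) + 2 * ((a div 2) XOR (b div 2))"
      using less.prems rec(1) by simp
    then have "c div 2 < (a div 2) XOR (b div 2) \<or>
        c div 2 = (a div 2) XOR (b div 2) \<and> even c \<and> odd a \<noteq> odd b"
      unfolding of_bool_def by presburger
    then show ?thesis using that by blast
  qed
  then show ?case
  proof cases
    case 1
    have "a div 2 + b div 2 < a + b"
      using less.prems by (cases "a = 0"; cases "b = 0") auto
    from less.hyps[OF this 1]
    have "(c div 2) XOR (b div 2) < a div 2 \<or> (c div 2) XOR (a div 2) < b div 2" .
    then show ?thesis
    proof
      assume "(c div 2) XOR (b div 2) < a div 2"
      then have "c XOR b < a" unfolding rec(2) of_bool_def by presburger
      then show ?thesis ..
    next
      assume "(c div 2) XOR (a div 2) < b div 2"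
      then have "c XOR a < b" unfolding rec(3) of_bool_def by presburger
      then show ?thesis ..
    qed
  next
    case 2
    \<comment> \<open>As \<open>c\<close> is even, the odd one of \<open>a\<close> and
      \<open>b\<close> loses exactly its lowest bit.\<close>
    then have "(c div 2) XOR (b div 2) = a div 2" "(c div 2) XOR (a div 2) = b div 2"
      by (simp_all add: ac_simps xor.assoc[symmetric])
    then show ?thesis using rec(2,3) 2 by (cases "odd a") (auto elim!: evenE oddE)
  qed
qed

lemma xor_nat_cancel_left: "a XOR b = a XOR c \<longleftrightarrow> b = (c :: nat)"
  by (metis xor.assoc xor_self_eq xor.left_neutral)

lemma xor_nat_cancel_right: "b XOR a = c XOR a \<longleftrightarrow> b = (c :: nat)"
  by (simp add: xor.commute[of _ a] xor_nat_cancel_left)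

text \<open>The bit \<open>n\<close> is not set in \<open>r\<close>, so nothing carries.\<close>

lemma power_of_two_xor:
  fixes r :: nat
  assumes "r < 2 ^ n"
  shows "2 ^ n XOR r = 2 ^ n + r"
proof (rule disjunctive_add_eq_xor[symmetric])
  have "\<not> bit r n" using assms by (simp add: bit_iff_odd)
  then show "2 ^ n AND r = 0" by (auto intro!: bit_eqI simp: bit_simps)
qed

subsection \<open>The ordered group of games\<close>

lemma left_opts_sum:
  "X |\<in>| left_opts (G \<oplus> H) \<longleftrightarrow>
     (\<exists>A. A |\<in>| left_opts G \<and> X = A \<oplus> H) \<or> (\<exists>B. B |\<in>| left_opts H \<and> X = G \<oplus> B)"
  by (subst game_sum.simps) auto

lemma right_opts_sum:
  "X |\<in>| right_opts (G \<oplus> H) \<longleftrightarrow>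
     (\<exists>A. A |\<in>| right_opts G \<and> X = A \<oplus> H) \<or> (\<exists>B. B |\<in>| right_opts H \<and> X = G \<oplus> B)"
  by (subst game_sum.simps) auto

lemma game_eqI:
  assumes "\<And>X. X |\<in>| left_opts G \<longleftrightarrow> X |\<in>| left_opts H"
    and "\<And>X. X |\<in>| right_opts G \<longleftrightarrow> X |\<in>| right_opts H"
  shows "G = H"
  using assms by (simp add: game.expand fset_eqI)

text \<open>Options form sets, so this law and associativity hold for the trees themselves, and
  later rewriting can use HOL equality instead of \<open>\<approx>\<close>.\<close>

lemma game_sum_commute: "G \<oplus> H = H \<oplus> G"
proof (induction "size G + size H" arbitrary: G H rule: less_induct)
  case less
  have "A \<oplus> H = H \<oplus> A" if "A |\<in>| left_opts G \<or> A |\<in>| right_opts G" for A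
    using less[of A H] that size_left_option size_right_option by fastforce
  moreover have "G \<oplus> A = A \<oplus> G" if "A |\<in>| left_opts H \<or> A |\<in>| right_opts H" for A
    using less[of G A] that size_left_option size_right_option by fastforce
  ultimately show ?case
    by (intro game_eqI) (auto simp: left_opts_sum right_opts_sum)
qed

lemma game_sum_assoc: "G \<oplus> H \<oplus> K = G \<oplus> (H \<oplus> K)"
proof (induction "size G + size H + size K" arbitrary: G H K rule: less_induct)
  case less
  have G: "A \<oplus> H \<oplus> K = A \<oplus> (H \<oplus> K)" if "A |\<in>| left_opts G \<or> A |\<in>| right_opts G" for A
    using less[of A H K] that size_left_option[of A G] size_right_option[of A G] by auto
  have H: "G \<oplus> A \<oplus> K = G \<oplus> (A \<oplus> K)" if "A |\<in>| left_opts H \<or> A |\<in>| right_opts H" for A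
    using less[of G A K] that size_left_option[of A H] size_right_option[of A H] by auto
  have K: "G \<oplus> H \<oplus> A = G \<oplus> (H \<oplus> A)" if "A |\<in>| left_opts K \<or> A |\<in>| right_opts K" for A
    using less[of G H A] that size_left_option[of A K] size_right_option[of A K] by auto
  show ?case
  proof (rule game_eqI)
    fix X
    have "X |\<in>| left_opts (G \<oplus> H \<oplus> K) \<longleftrightarrow>
        (\<exists>A. A |\<in>| left_opts G \<and> X = A \<oplus> H \<oplus> K) \<or>
        (\<exists>A. A |\<in>| left_opts H \<and> X = G \<oplus> A \<oplus> K) \<or>
        (\<exists>A. A |\<in>| left_opts K \<and> X = G \<oplus> H \<oplus> A)"
      unfolding left_opts_sum by blast
    also have "\<dots> \<longleftrightarrow>
        (\<exists>A. A |\<in>| left_opts G \<and> X = A \<oplus> (H \<oplus> K)) \<or>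
        (\<exists>A. A |\<in>| left_opts H \<and> X = G \<oplus> (A \<oplus> K)) \<or>
        (\<exists>A. A |\<in>| left_opts K \<and> X = G \<oplus> (H \<oplus> A))"
      using G H K by (simp cong: conj_cong)
    also have "\<dots> \<longleftrightarrow> X |\<in>| left_opts (G \<oplus> (H \<oplus> K))"
      unfolding left_opts_sum by blast
    finally show "X |\<in>| left_opts (G \<oplus> H \<oplus> K) \<longleftrightarrow> X |\<in>| left_opts (G \<oplus> (H \<oplus> K))" .
    have "X |\<in>| right_opts (G \<oplus> H \<oplus> K) \<longleftrightarrow>
        (\<exists>A. A |\<in>| right_opts G \<and> X = A \<oplus> H \<oplus> K) \<or>
        (\<exists>A. A |\<in>| right_opts H \<and> X = G \<oplus> A \<oplus> K) \<or>
        (\<exists>A. A |\<in>| right_opts K \<and> X = G \<oplus> H \<oplus> A)"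
      unfolding right_opts_sum by blast
    also have "\<dots> \<longleftrightarrow>
        (\<exists>A. A |\<in>| right_opts G \<and> X = A \<oplus> (H \<oplus> K)) \<or>
        (\<exists>A. A |\<in>| right_opts H \<and> X = G \<oplus> (A \<oplus> K)) \<or>
        (\<exists>A. A |\<in>| right_opts K \<and> X = G \<oplus> (H \<oplus> A))"
      using G H K by (simp cong: conj_cong)
    also have "\<dots> \<longleftrightarrow> X |\<in>| right_opts (G \<oplus> (H \<oplus> K))"
      unfolding right_opts_sum by blast
    finally show "X |\<in>| right_opts (G \<oplus> H \<oplus> K) \<longleftrightarrow> X |\<in>| right_opts (G \<oplus> (H \<oplus> K))" .
  qed
qed

text \<open>The recursion for \<open>\<preceq>\<close> passes through negations, so each direction
  calls on the other for smaller games; hence a single induction on the equivalence.\<close>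

lemma game_sum_le_cancel_right: "G \<oplus> K \<preceq> H \<oplus> K \<longleftrightarrow> G \<preceq> H"
proof (induction "size G + size H + size K" arbitrary: G H K rule: less_induct)
  case less
  show ?case
  proof
    assume le: "G \<oplus> K \<preceq> H \<oplus> K"
    show "G \<preceq> H"
    proof (rule game_leI)
      fix A assume A: "A |\<in>| left_opts G"
      then have "\<not> H \<oplus> K \<preceq> A \<oplus> K"
        using le game_le.simps[of "G \<oplus> K" "H \<oplus> K"] left_opts_sum by blast
      then show "\<not> H \<preceq> A" using less[of H A K] size_left_option[OF A] by simp
    next
      fix B assume B: "B |\<in>| right_opts H"
      then have "\<not> B \<oplus> K \<preceq> G \<oplus> K"
        using le game_le.simps[of "G \<oplus> K" "H \<oplus> K"] right_opts_sum by blast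
      then show "\<not> B \<preceq> G" using less[of B G K] size_right_option[OF B] by simp
    qed
  next
    assume le: "G \<preceq> H"
    show "G \<oplus> K \<preceq> H \<oplus> K"
    proof (rule game_leI)
      fix X assume "X |\<in>| left_opts (G \<oplus> K)"
      then consider A where "A |\<in>| left_opts G" "X = A \<oplus> K"
        | C where "C |\<in>| left_opts K" "X = G \<oplus> C"
        unfolding left_opts_sum by blast
      then show "\<not> H \<oplus> K \<preceq> X"
      proof cases
        case 1
        then show ?thesis
          using less[of H A K] size_left_option[OF 1(1)] le game_le.simps[of G H] by simp
      next
        case 2
        \<comment> \<open>Left's move in \<open>K\<close> is copied in the other sum, where by
          induction it is at least as good.\<close>
        then have "X \<preceq> H \<oplus> C" using less[of G H C] size_left_option[OF 2(1)] le by simp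
        moreover have "H \<oplus> C |\<in>| left_opts (H \<oplus> K)" using 2 left_opts_sum by blast
        ultimately show ?thesis by (rule not_le_if_le_left)
      qed
    next
      fix X assume "X |\<in>| right_opts (H \<oplus> K)"
      then consider A where "A |\<in>| right_opts H" "X = A \<oplus> K"
        | C where "C |\<in>| right_opts K" "X = H \<oplus> C"
        unfolding right_opts_sum by blast
      then show "\<not> X \<preceq> G \<oplus> K"
      proof cases
        case 1
        then show ?thesis
          using less[of A G K] size_right_option[OF 1(1)] le game_le.simps[of G H] by simp
      next
        case 2
        then have "G \<oplus> C \<preceq> X" using less[of G H C] size_right_option[OF 2(1)] le by simp
        moreover have "G \<oplus> C |\<in>| right_opts (G \<oplus> K)" using 2 right_opts_sum by blast
        ultimately show ?thesis by (rule not_le_if_right_le)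
      qed
    qed
  qed
qed

lemma game_sum_eq_cancel_right: "G \<oplus> K \<approx> H \<oplus> K \<longleftrightarrow> G \<approx> H"
  by (simp add: game_eq_def game_sum_le_cancel_right)

lemma game_sum_eq_cancel_left: "K \<oplus> G \<approx> K \<oplus> H \<longleftrightarrow> G \<approx> H"
  by (simp add: game_sum_commute[of K] game_sum_eq_cancel_right)

lemma game_sum_le_cancel_left: "K \<oplus> G \<preceq> K \<oplus> H \<longleftrightarrow> G \<preceq> H"
  by (simp add: game_sum_commute[of K] game_sum_le_cancel_right)

lemma game_sum_zero: "G \<oplus> nimber 0 = G"
proof (induction "size G" arbitrary: G rule: less_induct)
  case less
  then show ?case
    by (intro game_eqI)
      (auto simp: left_opts_sum right_opts_sum left_opts_nimber right_opts_nimber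
        size_left_option size_right_option)
qed

section \<open>Negation and additive inverses\<close>

primrec game_neg :: "game \<Rightarrow> game" where
  "game_neg (Game L R) = Game (game_neg |`| R) (game_neg |`| L)"

lemma left_opts_neg:
  "X |\<in>| left_opts (game_neg G) \<longleftrightarrow> (\<exists>A. A |\<in>| right_opts G \<and> X = game_neg A)"
  by (cases G) auto

lemma right_opts_neg:
  "X |\<in>| right_opts (game_neg G) \<longleftrightarrow> (\<exists>A. A |\<in>| left_opts G \<and> X = game_neg A)"
  by (cases G) auto

lemma game_neg_neg: "game_neg (game_neg G) = G"
proof (induction "size G" arbitrary: G rule: less_induct)
  case less
  then show ?case
    by (intro game_eqI)
      (simp_all add: left_opts_neg right_opts_neg, (metis size_left_option size_right_option)+)
qed

lemma game_neg_inject: "game_neg G = game_neg H \<longleftrightarrow> G = H"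
  by (metis game_neg_neg)

lemma game_neg_sum: "game_neg (G \<oplus> H) = game_neg G \<oplus> game_neg H"
proof (induction "size G + size H" arbitrary: G H rule: less_induct)
  case less
  have opts: "left_opts (game_neg K) = game_neg |`| right_opts K"
    "right_opts (game_neg K) = game_neg |`| left_opts K" for K
    by (cases K; simp)+
  have "game_neg (A \<oplus> H) = game_neg A \<oplus> game_neg H"
    if "A |\<in>| left_opts G \<or> A |\<in>| right_opts G" for A
    using less[of A H] that size_left_option size_right_option by fastforce
  then have G: "(\<lambda>A. game_neg (A \<oplus> H)) |`| left_opts G = (\<lambda>A. game_neg A \<oplus> game_neg H) |`| left_opts G"
    "(\<lambda>A. game_neg (A \<oplus> H)) |`| right_opts G = (\<lambda>A. game_neg A \<oplus> game_neg H) |`| right_opts G"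
    by (intro fset.map_cong refl; simp)+
  have "game_neg (G \<oplus> A) = game_neg G \<oplus> game_neg A"
    if "A |\<in>| left_opts H \<or> A |\<in>| right_opts H" for A
    using less[of G A] that size_left_option size_right_option by fastforce
  then have H: "(\<lambda>A. game_neg (G \<oplus> A)) |`| left_opts H = (\<lambda>A. game_neg G \<oplus> game_neg A) |`| left_opts H"
    "(\<lambda>A. game_neg (G \<oplus> A)) |`| right_opts H = (\<lambda>A. game_neg G \<oplus> game_neg A) |`| right_opts H"
    by (intro fset.map_cong refl; simp)+
  show ?case
    unfolding game_sum.simps[of G H] game_sum.simps[of "game_neg G" "game_neg H"]
    by (simp add: opts fimage_funion fset.map_comp o_def G H)
qed

lemma game_neg_nimber: "game_neg (nimber k) = nimber k"
proof (induction k rule: less_induct)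
  case (less k)
  then show ?case
    by (intro game_eqI)
      (simp_all add: left_opts_neg right_opts_neg left_opts_nimber right_opts_nimber, metis+)
qed

lemma game_neg_le_iff: "game_neg G \<preceq> game_neg H \<longleftrightarrow> H \<preceq> G"
proof (induction "size G + size H" arbitrary: G H rule: less_induct)
  case less
  have "game_neg H \<preceq> game_neg A \<longleftrightarrow> A \<preceq> H" if "A |\<in>| right_opts G" for A
    using less[of H A] size_right_option[OF that] by simp
  moreover have "game_neg A \<preceq> game_neg G \<longleftrightarrow> G \<preceq> A" if "A |\<in>| left_opts H" for A
    using less[of A G] size_left_option[OF that] by simp
  ultimately show ?case
    unfolding game_le.simps[of "game_neg G"] game_le.simps[of H]
    by (auto simp: left_opts_neg right_opts_neg)
qed

lemma game_neg_eq_iff: "game_neg G \<approx> game_neg H \<longleftrightarrow> G \<approx> H"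
  by (auto simp: game_eq_def game_neg_le_iff)

text \<open>The mirror strategy: Right answers every move of Left by its reflection in the other
  summand, which leaves \<open>A \<oplus> game_neg A\<close> for an option \<open>A\<close> of
  \<open>G\<close>.\<close>

lemma game_sum_neg_le_zero: "G \<oplus> game_neg G \<preceq> nimber 0"
proof (induction "size G" arbitrary: G rule: less_induct)
  case less
  show ?case
  proof (rule game_leI)
    fix X assume "X |\<in>| left_opts (G \<oplus> game_neg G)"
    then consider A where "A |\<in>| left_opts G" "X = A \<oplus> game_neg G"
      | A where "A |\<in>| right_opts G" "X = G \<oplus> game_neg A"
      unfolding left_opts_sum left_opts_neg by auto
    then obtain A where "A \<oplus> game_neg A |\<in>| right_opts X" "A \<oplus> game_neg A \<preceq> nimber 0"
    proof cases
      case 1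
      then show ?thesis
        using that[of A] less[of A] size_left_option[OF 1(1)] right_opts_sum right_opts_neg by blast
    next
      case 2
      then show ?thesis
        using that[of A] less[of A] size_right_option[OF 2(1)] right_opts_sum by blast
    qed
    then show "\<not> nimber 0 \<preceq> X" using game_le.simps[of "nimber 0" X] by blast
  qed (simp add: right_opts_nimber)
qed

text \<open>Up to commutativity the sum is its own negative, so one inequality yields the
  other.\<close>

lemma game_sum_neg: "G \<oplus> game_neg G \<approx> nimber 0"
  using game_sum_neg_le_zero[of G]
    game_neg_le_iff[of "nimber 0" "G \<oplus> game_neg G"]
  by (simp add: game_eq_def game_neg_sum game_neg_neg game_neg_nimber game_sum_commute)

subsection \<open>Nim addition\<close>

text \<open>By cancellation for XOR no option of the sum has value \<open>nimber (a XOR b)\<close>,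
  and by \<open>xor_less_cases\<close> every smaller nimber is the value of an option. Distinct
  nimbers are incomparable, so this settles the inequality.\<close>

lemma nimber_sum: "nimber a \<oplus> nimber b \<approx> nimber (a XOR b)"
proof (induction "a + b" arbitrary: a b rule: less_induct)
  case less
  let ?S = "nimber a \<oplus> nimber b" and ?T = "nimber (a XOR b)"
  have le: "?S \<preceq> ?T"
  proof (rule game_leI)
    fix X assume "X |\<in>| left_opts ?S"
    then obtain c d where X: "X = nimber c \<oplus> nimber d" "c + d < a + b"
      "c < a \<and> d = b \<or> c = a \<and> d < b"
      unfolding left_opts_sum left_opts_nimber by force
    have "c XOR d \<noteq> a XOR b"
      using X(3) by (metis xor_nat_cancel_left xor_nat_cancel_right less_irrefl)
    moreover have "X \<preceq> nimber (c XOR d)" using less X(1,2) by (simp add: game_eq_def)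
    ultimately show "\<not> ?T \<preceq> X" using game_le_trans nimber_le_iff by metis
  next
    fix X assume "X |\<in>| right_opts ?T"
    then obtain c where c: "X = nimber c" "c < a XOR b" unfolding right_opts_nimber by blast
    consider "c XOR b < a" | "c XOR a < b" using xor_less_cases[OF c(2)] by blast
    then show "\<not> X \<preceq> ?S"
    proof cases
      case 1
      then have "nimber (c XOR b) \<oplus> nimber b \<preceq> X"
        using less[of "c XOR b" b] c by (simp add: game_eq_def xor.assoc)
      moreover have "nimber (c XOR b) \<oplus> nimber b |\<in>| right_opts ?S"
        using 1 right_opts_sum right_opts_nimber by blast
      ultimately show ?thesis by (rule not_le_if_right_le)
    next
      case 2
      then have "nimber a \<oplus> nimber (c XOR a) \<preceq> X"
        using less[of a "c XOR a"] c
        by (simp add: game_eq_def xor.commute[of c] xor.assoc[symmetric])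
      moreover have "nimber a \<oplus> nimber (c XOR a) |\<in>| right_opts ?S"
        using 2 right_opts_sum right_opts_nimber by blast
      ultimately show ?thesis by (rule not_le_if_right_le)
    qed
  qed
  \<comment> \<open>Negation reverses the order and fixes both sides.\<close>
  then show ?case
    using game_neg_le_iff[of ?S ?T] by (simp add: game_eq_def game_neg_sum game_neg_nimber)
qed

lemma game_sum_nimber_nimber: "Z \<oplus> nimber a \<oplus> nimber b \<approx> Z \<oplus> nimber (a XOR b)"
  by (simp add: game_sum_assoc game_sum_eq_cancel_left nimber_sum)

text \<open>A nimber is its own inverse: add \<open>nimber a\<close> to both sides.\<close>

lemma game_sum_nimber_le_iff:
  "G \<oplus> nimber a \<preceq> H \<oplus> nimber b \<longleftrightarrow> G \<preceq> H \<oplus> nimber (a XOR b)"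
proof -
  have "G \<oplus> nimber a \<oplus> nimber a \<approx> G"
    using game_sum_nimber_nimber[of G a a] by (simp add: game_sum_zero)
  moreover have "H \<oplus> nimber b \<oplus> nimber a \<approx> H \<oplus> nimber (a XOR b)"
    using game_sum_nimber_nimber[of H b a] by (simp add: xor.commute)
  ultimately have "G \<oplus> nimber a \<oplus> nimber a \<preceq> H \<oplus> nimber b \<oplus> nimber a \<longleftrightarrow>
      G \<preceq> H \<oplus> nimber (a XOR b)"
    unfolding game_eq_def using game_le_trans by blast
  then show ?thesis by (simp add: game_sum_le_cancel_right)
qed

lemma le_game_sum_nimber_iff: "G \<preceq> H \<oplus> nimber a \<longleftrightarrow> G \<oplus> nimber a \<preceq> H"
  using game_sum_nimber_le_iff[of G a H 0] by (simp add: game_sum_zero)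

subsection \<open>Birthdays\<close>

lemma canonical_canonical_form: "canonical (canonical_form G)"
  and canonical_form_eq: "canonical_form G \<approx> G"
  using theI'[OF canonical_form_ex1[of G]] unfolding canonical_form_def by blast+

lemma birthday_cong: "G \<approx> H \<Longrightarrow> birthday G = birthday H"
  unfolding birthday_def
  using canonical_form_eqI[OF canonical_canonical_form, of H G]
    game_eq_trans[OF canonical_form_eq game_eq_sym, of G H] by simp

lemma birthday_canonical: "canonical G \<Longrightarrow> birthday G = height G"
  using canonical_form_eqI[OF _ game_eq_refl] by (simp add: birthday_def)

lemma height_less:
  assumes "X |\<in>| left_opts G \<or> X |\<in>| right_opts G"
  shows "height X < height G"
proof -
  have "Suc (height X) \<le> height G"
    unfolding height.simps[of G] using assms by (intro Max_ge) auto
  then show ?thesis by simp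
qed

lemma height_neg: "height (game_neg G) = height G"
proof (induction "size G" arbitrary: G rule: less_induct)
  case less
  have "(\<lambda>X. Suc (height X)) ` (fset (left_opts (game_neg G)) \<union> fset (right_opts (game_neg G)))
    = (\<lambda>X. Suc (height (game_neg X))) ` (fset (left_opts G) \<union> fset (right_opts G))"
    by (force simp: left_opts_neg right_opts_neg)
  also have "\<dots> = (\<lambda>X. Suc (height X)) ` (fset (left_opts G) \<union> fset (right_opts G))"
    using less size_left_option size_right_option by (intro image_cong) auto
  finally show ?case by (simp add: height.simps[of "game_neg G"] height.simps[of G])
qed

lemma canonical_neg: "canonical G \<Longrightarrow> canonical (game_neg G)"
proof (induction "size G" arbitrary: G rule: less_induct)
  case less
  have "canonical (game_neg A)" if "A |\<in>| left_opts G \<or> A |\<in>| right_opts G" for A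
    using that less canonical_left_option canonical_right_option size_left_option size_right_option
    by blast
  moreover have "no_dominated_opts (game_neg G)"
    using less.prems canonical.simps[of G]
    by (simp add: no_dominated_opts_def left_opts_neg right_opts_neg) (metis game_neg_le_iff)
  moreover have "no_reversible_opts (game_neg G)"
    using less.prems canonical.simps[of G]
    by (auto simp: no_reversible_opts_def left_opts_neg right_opts_neg game_neg_le_iff)
  ultimately show ?case
    by (auto simp: canonical.simps[of "game_neg G"] left_opts_neg right_opts_neg)
qed

lemma birthday_neg: "birthday (game_neg G) = birthday G"
proof -
  have "canonical_form (game_neg G) = game_neg (canonical_form G)"
    by (intro canonical_form_eqI canonical_neg canonical_canonical_form)
      (simp add: game_neg_eq_iff canonical_form_eq)
  then show ?thesis by (simp add: birthday_def height_neg)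
qed

section \<open>Options that survive in the canonical form\<close>

text \<open>Such an option has the value of some left option of the canonical form of
  \<open>G\<close>, although \<open>G\<close> itself need not be canonical.\<close>

lemma birthday_left_option_less:
  assumes A: "A |\<in>| left_opts G"
    and undominated: "\<And>B. B |\<in>| left_opts G \<Longrightarrow> A \<preceq> B \<Longrightarrow> B \<preceq> A"
    and irreversible: "\<And>X. X |\<in>| right_opts A \<Longrightarrow> \<not> X \<preceq> G"
  shows "birthday A < birthday G"
proof -
  define K where "K = canonical_form G"
  have K: "canonical K" "K \<preceq> G" "G \<preceq> K"
    using canonical_canonical_form canonical_form_eq unfolding K_def game_eq_def by blast+
  have "\<not> K \<preceq> A" using K(3) A game_le.simps[of G K] by blast
  moreover have "\<not> X \<preceq> K" if "X |\<in>| right_opts A" for X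
    using that irreversible K(2) game_le_trans by blast
  \<comment> \<open>\<open>K \<preceq> A\<close> can now fail only because of a left option of
    \<open>K\<close> that is at least \<open>A\<close>.\<close>
  ultimately obtain B where B: "B |\<in>| left_opts K" "A \<preceq> B"
    using game_le.simps[of K A] by blast
  have "\<not> G \<preceq> B" using K(2) B(1) game_le.simps[of K G] by blast
  moreover have "\<not> X \<preceq> G" if "X |\<in>| right_opts B" for X
    using that B(1) K game_le_trans[of X G K] canonical.simps[of K]
    unfolding no_reversible_opts_def by blast
  ultimately obtain C where C: "C |\<in>| left_opts G" "B \<preceq> C"
    using game_le.simps[of G B] by blast
  \<comment> \<open>The chain \<open>A \<preceq> B \<preceq> C\<close> closes up, since
    \<open>C\<close> is again an option of \<open>G\<close>.\<close>
  have "B \<preceq> A" using undominated[of C] B C game_le_trans by blast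
  then have "birthday A = birthday B" using B(2) by (intro birthday_cong) (simp add: game_eq_def)
  also have "\<dots> = height B" using K(1) B(1) canonical_left_option birthday_canonical by blast
  also have "\<dots> < height K" using B(1) height_less by blast
  finally show ?thesis by (simp add: K_def birthday_def)
qed

text \<open>The assumptions put \<open>A\<close> strictly above \<open>Z \<oplus> nimber j\<close>,
  and hence below no \<open>Z \<oplus> nimber r\<close>, distinct nimbers being incomparable. So no
  move in the nimber dominates or reverses \<open>A \<oplus> nimber q\<close>; moves in
  \<open>Z\<close> and \<open>A\<close> are excluded by canonicity of \<open>Z\<close>.\<close>

lemma birthday_add_nimber_left_option_less:
  assumes Z: "canonical Z" and A: "A |\<in>| left_opts Z" and j: "Z \<oplus> nimber j \<preceq> A"
    and ne: "\<And>r. \<not> A \<approx> Z \<oplus> nimber r"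
  shows "birthday (A \<oplus> nimber q) < birthday (Z \<oplus> nimber q)"
proof (rule birthday_left_option_less)
  have no: "\<not> A \<preceq> Z \<oplus> nimber r" for r
  proof
    assume r: "A \<preceq> Z \<oplus> nimber r"
    then have "nimber j \<preceq> nimber r" using j game_le_trans game_sum_le_cancel_left by blast
    then show False using r j ne[of r] by (simp add: nimber_le_iff game_eq_def)
  qed
  show "A \<oplus> nimber q |\<in>| left_opts (Z \<oplus> nimber q)" using A left_opts_sum by blast
  show "B \<preceq> A \<oplus> nimber q"
    if "B |\<in>| left_opts (Z \<oplus> nimber q)" "A \<oplus> nimber q \<preceq> B" for B
  proof -
    have "C \<preceq> A" if "C |\<in>| left_opts Z" "A \<preceq> C" for C
      using that A Z canonical.simps[of Z] game_le_refl unfolding no_dominated_opts_def by blast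
    then show ?thesis
      using that no
      by (auto simp: left_opts_sum left_opts_nimber game_sum_zero game_sum_nimber_le_iff)
  qed
  show "\<not> X \<preceq> Z \<oplus> nimber q" if "X |\<in>| right_opts (A \<oplus> nimber q)" for X
    using that no A Z canonical.simps[of Z]
    by (auto simp: right_opts_sum right_opts_nimber game_sum_zero
        game_sum_nimber_le_iff no_reversible_opts_def)
qed

text \<open>Negation exchanges the players, fixes nimbers and preserves birthdays.\<close>

lemma birthday_add_nimber_right_option_less:
  assumes Z: "canonical Z" and A: "A |\<in>| right_opts Z" and j: "A \<preceq> Z \<oplus> nimber j"
    and ne: "\<And>r. \<not> A \<approx> Z \<oplus> nimber r"
  shows "birthday (A \<oplus> nimber q) < birthday (Z \<oplus> nimber q)"
proof -
  have neg: "game_neg Z \<oplus> nimber r = game_neg (Z \<oplus> nimber r)" for Z r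
    by (simp add: game_neg_sum game_neg_nimber)
  have "birthday (game_neg A \<oplus> nimber q) < birthday (game_neg Z \<oplus> nimber q)"
    by (rule birthday_add_nimber_left_option_less[where j = j])
      (use assms in \<open>simp_all add: neg canonical_neg left_opts_neg game_neg_le_iff game_neg_eq_iff game_neg_inject\<close>)
  then show ?thesis by (simp add: neg birthday_neg)
qed

text \<open>For \<open>p < q\<close> the hypotheses keep the left option
  \<open>Z \<oplus> nimber p\<close> from being dominated or reversed, so the birthday grows by at
  least one with each step of \<open>q\<close>.\<close>

lemma birthday_add_nimber_ge:
  assumes left: "\<And>A j. A |\<in>| left_opts Z \<Longrightarrow> \<not> Z \<oplus> nimber j \<preceq> A"
    and right: "\<And>A j. A |\<in>| right_opts Z \<Longrightarrow> \<not> A \<preceq> Z \<oplus> nimber j"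
  shows "q \<le> birthday (Z \<oplus> nimber q)"
proof -
  have less: "birthday (Z \<oplus> nimber p) < birthday (Z \<oplus> nimber q)" if "p < q" for p q
  proof (rule birthday_left_option_less)
    show "Z \<oplus> nimber p |\<in>| left_opts (Z \<oplus> nimber q)"
      using that left_opts_sum left_opts_nimber by blast
    show "B \<preceq> Z \<oplus> nimber p"
      if "B |\<in>| left_opts (Z \<oplus> nimber q)" "Z \<oplus> nimber p \<preceq> B" for B
    proof -
      \<comment> \<open>Collecting the nimbers turns such a domination into
        \<open>Z \<oplus> nimber (p XOR q) \<preceq> A\<close>.\<close>
      have "\<not> Z \<oplus> nimber p \<preceq> A \<oplus> nimber q" if "A |\<in>| left_opts Z" for A
        using left[OF that]
        unfolding game_sum_nimber_le_iff unfolding le_game_sum_nimber_iff by blast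
      then show ?thesis
        using that by (auto simp: left_opts_sum left_opts_nimber game_sum_le_cancel_left nimber_le_iff)
    qed
    \<comment> \<open>Moves in \<open>Z\<close> are excluded by \<open>right\<close>; a move in the
      nimber leads to some \<open>Z \<oplus> nimber r\<close> with \<open>r < p < q\<close>, which
      is incomparable with \<open>Z \<oplus> nimber q\<close>.\<close>
    show "\<not> X \<preceq> Z \<oplus> nimber q" if "X |\<in>| right_opts (Z \<oplus> nimber p)" for X
      using that right \<open>p < q\<close>
      by (auto simp: right_opts_sum right_opts_nimber game_sum_nimber_le_iff
          game_sum_le_cancel_left nimber_le_iff)
  qed
  show ?thesis
  proof (induction q)
    case (Suc q)
    then show ?case using less[of q "Suc q"] by simp
  qed simp
qed

text \<open>For \<open>Z = nimber m\<close> the bound is exact, by nim addition. One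
  \<open>m\<close> serves all \<open>q\<close>, so an estimate of \<open>m\<close> from one
  \<open>q\<close> can be used at another.\<close>

lemma birthday_add_nimber_ge_xor: "\<exists>m. \<forall>q. q XOR m \<le> birthday (Z \<oplus> nimber q)"
proof (induction "birthday Z" arbitrary: Z rule: less_induct)
  case less
  define K where "K = canonical_form Z"
  have K: "canonical K" "K \<approx> Z" "birthday K = birthday Z"
    using canonical_canonical_form canonical_form_eq birthday_cong unfolding K_def by blast+
  have KZ: "birthday (K \<oplus> nimber q) = birthday (Z \<oplus> nimber q)" for q
    using K(2) by (intro birthday_cong) (simp add: game_sum_eq_cancel_right)
  show ?case
  proof (cases "\<exists>r. birthday (Z \<oplus> nimber r) < birthday Z")
    case True
    then obtain r m where m: "\<And>q. q XOR m \<le> birthday (Z \<oplus> nimber r \<oplus> nimber q)"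
      using less by blast
    \<comment> \<open>Adding \<open>nimber r\<close> only permutes the values of \<open>q\<close>,
      which shifts the witness \<open>m\<close> to \<open>r XOR m\<close>.\<close>
    have "q XOR (r XOR m) \<le> birthday (Z \<oplus> nimber q)" for q
    proof -
      have "Z \<oplus> nimber r \<oplus> nimber (r XOR q) \<approx> Z \<oplus> nimber (r XOR (r XOR q))"
        by (rule game_sum_nimber_nimber)
      also have "r XOR (r XOR q) = q" by (simp add: xor.assoc[symmetric])
      finally show ?thesis using m[of "r XOR q"] birthday_cong by (simp add: ac_simps)
    qed
    then show ?thesis by blast
  next
    case minimal: False
    \<comment> \<open>The witness for \<open>A\<close> also works for \<open>Z\<close>, because
      \<open>A \<oplus> nimber q\<close> is born before \<open>Z \<oplus> nimber q\<close> for every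
      \<open>q\<close>.\<close>
    have ex: ?thesis
      if A: "A |\<in>| left_opts K \<or> A |\<in>| right_opts K"
        and lt: "(\<And>r. \<not> A \<approx> K \<oplus> nimber r) \<Longrightarrow>
          \<forall>q. birthday (A \<oplus> nimber q) < birthday (K \<oplus> nimber q)" for A
    proof -
      have "birthday A < birthday Z"
        using A K height_less canonical_left_option canonical_right_option birthday_canonical by metis
      \<comment> \<open>Otherwise some \<open>Z \<oplus> nimber r\<close> would be born before
        \<open>Z\<close>, against minimality.\<close>
      moreover from this have "\<not> A \<approx> K \<oplus> nimber r" for r
        using minimal KZ birthday_cong by metis
      ultimately show ?thesis using less[of A] lt KZ by (metis less_imp_le order_trans)
    qed
    consider A j where "A |\<in>| left_opts K" "K \<oplus> nimber j \<preceq> A"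
      | A j where "A |\<in>| right_opts K" "A \<preceq> K \<oplus> nimber j"
      | "\<And>A j. A |\<in>| left_opts K \<Longrightarrow> \<not> K \<oplus> nimber j \<preceq> A"
        "\<And>A j. A |\<in>| right_opts K \<Longrightarrow> \<not> A \<preceq> K \<oplus> nimber j"
      by blast
    then show ?thesis
    proof cases
      case 1
      then show ?thesis using ex[of A] birthday_add_nimber_left_option_less[OF K(1)] by blast
    next
      case 2
      then show ?thesis using ex[of A] birthday_add_nimber_right_option_less[OF K(1)] by blast
    next
      case 3
      have "q XOR 0 \<le> birthday (Z \<oplus> nimber q)" for q
        using birthday_add_nimber_ge[OF 3] KZ by simp
      then show ?thesis by blast
    qed
  qed
qed

section \<open>Nimbers and powers of two\<close>

theorem theorem25:
  fixes k :: nat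
  assumes "k > 0"
  shows "indecomposable (nimber k) \<longleftrightarrow> (\<exists>n::nat. k = 2 ^ n)"
proof
  assume indec: "indecomposable (nimber k)"
  \<comment> \<open>\<open>n\<close> is the position of the leading binary digit of
    \<open>k\<close>, which exists as \<open>k > 0\<close>.\<close>
  obtain n where n: "2 ^ n \<le> k" "k < 2 ^ Suc n"
    using assms ex_power_ivl1[of 2 k] by auto
  define r where "r = k - 2 ^ n"
  have r: "k = 2 ^ n + r" "r < 2 ^ n" using n by (auto simp: r_def)
  have "nimber k \<approx> nimber (2 ^ n) \<oplus> nimber r"
    using nimber_sum[of "2 ^ n" r] r power_of_two_xor[OF r(2)] game_eq_sym by simp
  \<comment> \<open>A nimber has its index as birthday, so otherwise the two summands would
    decompose \<open>nimber k\<close>.\<close>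
  then have "\<not> (2 ^ n < k \<and> r < k)"
    using indec birthday_nimber unfolding decomposable_def by metis
  then have "k = 2 ^ n" using r by auto
  then show "\<exists>n. k = 2 ^ n" ..
next
  assume "\<exists>n. k = 2 ^ n"
  then obtain n where k: "k = 2 ^ n" ..
  show "indecomposable (nimber k)"
  proof
    assume "decomposable (nimber k)"
    then obtain H J where H: "birthday H < k" and J: "birthday J < k"
      and sum: "nimber k \<approx> H \<oplus> J"
      unfolding decomposable_def birthday_nimber by blast
    \<comment> \<open>Adding the negative of \<open>H\<close> solves the equation for
      \<open>J\<close>.\<close>
    have "game_neg H \<oplus> nimber k \<approx> game_neg H \<oplus> (H \<oplus> J)"
      using sum by (simp add: game_sum_eq_cancel_left)
    also have "game_neg H \<oplus> (H \<oplus> J) = J \<oplus> (H \<oplus> game_neg H)"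
      by (metis game_sum_assoc game_sum_commute)
    finally have "game_neg H \<oplus> nimber k \<approx> J"
      using game_sum_neg[of H] game_sum_eq_cancel_left game_eq_trans game_sum_zero by metis
    then have bJ: "birthday (game_neg H \<oplus> nimber k) = birthday J" by (rule birthday_cong)
    obtain m where m: "\<And>q. q XOR m \<le> birthday (game_neg H \<oplus> nimber q)"
      using birthday_add_nimber_ge_xor by blast
    have "m < k" using m[of 0] H by (simp add: game_sum_zero birthday_neg)
    \<comment> \<open>As a power of two above \<open>m\<close>, \<open>k\<close> shares no bit with
      \<open>m\<close>, so XOR adds them.\<close>
    then have "k \<le> k XOR m" using power_of_two_xor[of m n] k by simp
    then show False using m[of k] J bJ by simp
  qed
qed

end
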